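(* For each integer $k\ge 15$, there exists a Hamiltonian (i.e. closed) Euclidean zebra's tour on $C(2,k)=\{0,1\}^k$; that is, there exists an ordering $V_1,V_2,\dots,V_{2^k}$ of all the elements of $\{0,1\}^k$, each occurring exactly once, such that $\|V_i-V_{i+1}\|=\sqrt{13}$ for every $1\le i\le 2^k-1$ and $\|V_{2^k}-V_1\|=\sqrt{13}$.
   Context: For positive integers $n,k$, $C(n,k):=\{0,1,\dots,n-1\}^k$ and $\|\cdot\|$ is the Euclidean norm on $\mathbb{R}^k$. The $(a,b)$-leaper is the fairy chess piece that may jump between any two vertices of $C(n,k)$ whose Euclidean distance is exactly $\sqrt{a^2+b^2}$. The zebra is the $(2,3)$-leaper, so its jump length is $\sqrt{2^2+3^2}=\sqrt{13}$. A Euclidean tour of a leaper on $C(n,k)$ is a sequence listing every vertex of $C(n,k)$ exactly once in which any two consecutive vertices are at the leaper's jump distance. It is closed (Hamiltonian) if the last and the first vertices are also at the leaper's jump distance. *)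

theory Defs
  imports "HOL-Analysis.Analysis"
begin

text \<open>
  The grid \<open>C(n,k) = {0,\<dots>,n-1}\<^sup>k\<close> as a subset of Euclidean \<open>k\<close>-space; the dimension is
  carried by the index type, \<open>k = CARD('k)\<close>.
\<close>

definition grid :: "nat \<Rightarrow> (real ^ 'k) set" where
  "grid n = {v. \<forall>i. v $ i \<in> real ` {0..<n}}"

definition leaper_jump :: "nat \<Rightarrow> nat \<Rightarrow> real ^ 'k \<Rightarrow> real ^ 'k \<Rightarrow> bool" where
  "leaper_jump a b u v \<longleftrightarrow> norm (u - v) = sqrt ((real a)\<^sup>2 + (real b)\<^sup>2)"

definition euclidean_tour :: "nat \<Rightarrow> nat \<Rightarrow> nat \<Rightarrow> (real ^ 'k) list \<Rightarrow> bool" where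
  "euclidean_tour a b n Vs \<longleftrightarrow>
     distinct Vs \<and> set Vs = grid n \<and> successively (leaper_jump a b) Vs"

text \<open>For \<open>n \<ge> 1\<close> the grid is nonempty, so \<open>last\<close> and \<open>hd\<close> are meaningful below.\<close>

definition closed_euclidean_tour :: "nat \<Rightarrow> nat \<Rightarrow> nat \<Rightarrow> (real ^ 'k) list \<Rightarrow> bool" where
  "closed_euclidean_tour a b n Vs \<longleftrightarrow>
     euclidean_tour a b n Vs \<and> leaper_jump a b (last Vs) (hd Vs)"

abbreviation closed_euclidean_zebra_tour :: "nat \<Rightarrow> (real ^ 'k) list \<Rightarrow> bool" where
  "closed_euclidean_zebra_tour \<equiv> closed_euclidean_tour 2 3"

end

theory Submission imports Defs
begin

text \<open>
  Identify the vertices of the cube with the subsets of the index type, which form a group under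
  symmetric difference; a jump adds a set of \<open>m = a\<^sup>2 + b\<^sup>2\<close> elements. If a cycle runs through a
  subgroup \<open>H\<close> and \<open>S \<notin> H\<close> has \<open>m\<close> elements, then, as in the reflected Gray code, following the
  cycle from \<open>{}\<close> to its end and then traversing its translate by \<open>S\<close> backwards gives a cycle through
  the subgroup \<open>H \<union> (H + S)\<close>. So a longest such cycle runs through a subgroup containing all sets with
  \<open>m\<close> elements, and for odd \<open>m < k\<close> these generate the whole group.
\<close>

text \<open>Two sets of \<open>m\<close> elements that differ by exchanging \<open>i\<close> for
  \<open>j\<close> add up to \<open>{i, j}\<close>. Pairs generate all sets of even size; since
  \<open>m - 1\<close> is even, adding to a set of \<open>m\<close> elements all but one of them
  leaves a singleton.\<close>

lemma sym_diff_closed_eq_UNIV: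
  fixes H :: "'a::finite set set"
  assumes closed: "\<And>A B. A \<in> H \<Longrightarrow> B \<in> H \<Longrightarrow> sym_diff A B \<in> H"
    and "odd m" "m < CARD('a)" and m: "\<And>A. card A = m \<Longrightarrow> A \<in> H"
  shows "H = UNIV"
proof -
  \<comment> \<open>Keeps \<open>m - 1\<close> below from truncating: one more point makes
    \<open>m\<close> elements.\<close>
  have "m > 0" using \<open>odd m\<close> by (auto intro: Nat.gr0I)
  obtain A0 :: "'a set" where "card A0 = m"
    using \<open>m < CARD('a)\<close> by (metis less_imp_le obtain_subset_with_card_n)
  then have empty: "{} \<in> H" using closed[of A0 A0] m by simp
  have pair: "{i, j} \<in> H" if "i \<noteq> j" for i j
  proof -
    \<comment> \<open>The strict bound \<open>m < CARD('a)\<close> leaves room for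
      \<open>m - 1\<close> elements outside two points.\<close>
    have "m - 1 \<le> card (UNIV - {i, j})" using that assms(3) by (simp add: card_Diff_subset)
    then obtain T where T: "T \<subseteq> UNIV - {i, j}" "card T = m - 1"
      by (metis obtain_subset_with_card_n)
    then have "card (insert i T) = m" "card (insert j T) = m"
      using \<open>m > 0\<close> by (auto simp: card_insert_if)
    then have "sym_diff (insert i T) (insert j T) \<in> H" by (intro closed m)
    moreover have "sym_diff (insert i T) (insert j T) = {i, j}" using T that by auto
    ultimately show ?thesis by simp
  qed
  have even: "A \<in> H" if "card A = 2 * n" for A n
    using that
  proof (induction n arbitrary: A)
    case 0
    then show ?case using empty by simp
  next
    case (Suc n)
    then obtain i B where iB: "A = insert i B" "i \<notin> B" "card B = Suc (2 * n)"
      by (metis card_Suc_eq mult_Suc_right add_2_eq_Suc)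
    then obtain j C where jC: "B = insert j C" "j \<notin> C" "card C = 2 * n"
      by (metis card_Suc_eq)
    have "sym_diff {i, j} C \<in> H" using iB jC by (intro closed pair Suc.IH) auto
    moreover have "sym_diff {i, j} C = A" using iB jC by auto
    ultimately show ?case by simp
  qed
  have single: "{i} \<in> H" for i
  proof -
    have "m - 1 \<le> card (UNIV - {i})" using assms(3) by simp
    then obtain T where T: "T \<subseteq> UNIV - {i}" "card T = m - 1"
      by (metis obtain_subset_with_card_n)
    have "T \<in> H" using T(2) \<open>odd m\<close> by (auto elim!: oddE intro: even)
    moreover have "insert i T \<in> H" using T \<open>m > 0\<close> by (intro m) (auto simp: card_insert_if)
    ultimately have "sym_diff (insert i T) T \<in> H" by (intro closed)
    moreover have "sym_diff (insert i T) T = {i}" using T by auto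
    ultimately show ?thesis by simp
  qed
  have "A \<in> H" for A
    using finite[of A]
  proof induction
    case (insert i A)
    then have "sym_diff {i} A \<in> H" using single by (intro closed)
    moreover have "sym_diff {i} A = insert i A" using insert by auto
    ultimately show ?case by simp
  qed (fact empty)
  then show ?thesis by auto
qed

text \<open>As the cycle starts at \<open>{}\<close>, its closing jump adds the set
  \<open>last Vs\<close> itself. Every set is its own inverse, so closure under
  \<open>sym_diff\<close> makes \<open>set Vs\<close> a subgroup.\<close>

definition subgroup_cycle :: "nat \<Rightarrow> 'a set list \<Rightarrow> bool" where
  "subgroup_cycle m Vs \<longleftrightarrow>
     Vs \<noteq> [] \<and> hd Vs = {} \<and> card (last Vs) = m \<and> distinct Vs \<and>
     successively (\<lambda>A B. card (sym_diff A B) = m) Vs \<and>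
     (\<forall>A\<in>set Vs. \<forall>B\<in>set Vs. sym_diff A B \<in> set Vs)"

lemma sym_diff_cancel_right: "sym_diff (sym_diff A S) (sym_diff B S) = sym_diff A B"
  by blast

text \<open>Only two jumps are not inherited from \<open>Vs\<close>: the one joining the halves and
  the one closing the cycle. Both add \<open>S\<close>. The halves are distinct cosets of
  \<open>set Vs\<close>, hence disjoint.\<close>

lemma subgroup_cycle_extend:
  assumes "subgroup_cycle m Vs" "card S = m" "S \<notin> set Vs"
  shows "subgroup_cycle m (Vs @ map (\<lambda>A. sym_diff A S) (rev Vs))"
    (is "subgroup_cycle m (Vs @ ?Ws)")
proof -
  have Vs: "Vs \<noteq> []" "hd Vs = {}" "card (last Vs) = m" "distinct Vs"
    "successively (\<lambda>A B. card (sym_diff A B) = m) Vs"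
    and closed: "\<And>A B. A \<in> set Vs \<Longrightarrow> B \<in> set Vs \<Longrightarrow> sym_diff A B \<in> set Vs"
    using assms(1) unfolding subgroup_cycle_def by auto
  have "inj (\<lambda>A. sym_diff A S)"
    by (rule inj_on_inverseI[of _ "\<lambda>A. sym_diff A S"]) blast
  then have dist: "distinct ?Ws"
    using Vs by (simp add: distinct_map inj_on_subset[OF _ subset_UNIV])
  have disj: "set Vs \<inter> set ?Ws = {}"
  proof (rule ccontr)
    assume "set Vs \<inter> set ?Ws \<noteq> {}"
    then obtain A where "A \<in> set Vs" "sym_diff A S \<in> set Vs" by auto
    then have "sym_diff A (sym_diff A S) \<in> set Vs" by (rule closed)
    moreover have "sym_diff A (sym_diff A S) = S" by blast
    ultimately show False using assms(3) by simp
  qed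
  \<comment> \<open>Translation by \<open>S\<close> preserves symmetric differences, and reversal
    merely swaps their arguments.\<close>
  have "successively (\<lambda>A B. card (sym_diff A B) = m) ?Ws"
    unfolding successively_map successively_rev sym_diff_cancel_right
    using Vs(5) by (simp add: Un_commute)
  moreover have "sym_diff (last Vs) (sym_diff (last Vs) S) = S" by blast
  moreover have "hd ?Ws = sym_diff (last Vs) S"
    using Vs(1) by (simp add: hd_map hd_rev)
  ultimately have succ: "successively (\<lambda>A B. card (sym_diff A B) = m) (Vs @ ?Ws)"
    using Vs assms(2) by (simp add: successively_append_iff)
  have "last (Vs @ ?Ws) = S"
    using Vs by (simp add: last_map last_rev)
  have "sym_diff A B \<in> set (Vs @ ?Ws)" if "A \<in> set (Vs @ ?Ws)" "B \<in> set (Vs @ ?Ws)" for A B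
  proof -
    \<comment> \<open>Moving \<open>S\<close> outward shows that a sum across the two cosets lies in
      the translate.\<close>
    have *: "sym_diff (sym_diff A' S) B' = sym_diff (sym_diff A' B') S"
      "sym_diff A' (sym_diff B' S) = sym_diff (sym_diff A' B') S" for A' B' by blast+
    from that consider
      "A \<in> set Vs" "B \<in> set Vs"
      | B' where "A \<in> set Vs" "B' \<in> set Vs" "B = sym_diff B' S"
      | A' where "A' \<in> set Vs" "B \<in> set Vs" "A = sym_diff A' S"
      | A' B' where "A' \<in> set Vs" "B' \<in> set Vs" "A = sym_diff A' S" "B = sym_diff B' S"
      by auto
    then show ?thesis
    proof cases
      case 1
      then show ?thesis using closed by simp
    next
      case 2
      then show ?thesis unfolding 2(3) * using closed[OF 2(1,2)] by simp
    next
      case 3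
      then show ?thesis unfolding 3(3) * using closed[OF 3(1,2)] by simp
    next
      case 4
      then show ?thesis unfolding 4(3,4) sym_diff_cancel_right using closed[OF 4(1,2)] by simp
    qed
  qed
  with Vs dist disj succ \<open>last (Vs @ ?Ws) = S\<close> assms(2) show ?thesis
    unfolding subgroup_cycle_def by (simp only: distinct_append hd_append2) simp
qed

lemma ex_subgroup_cycle_UNIV:
  assumes "odd m" "m < CARD('a::finite)"
  shows "\<exists>Vs :: 'a set list. subgroup_cycle m Vs \<and> set Vs = UNIV"
proof -
  obtain S :: "'a set" where S: "card S = m"
    using assms(2) by (metis less_imp_le obtain_subset_with_card_n)
  moreover have "S \<noteq> {}" using S \<open>odd m\<close> by auto
  \<comment> \<open>The two-element subgroup generated by \<open>S\<close> starts the search; with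
    \<open>bound\<close>, a longest cycle exists.\<close>
  ultimately have start: "subgroup_cycle m [{}, S]" unfolding subgroup_cycle_def by simp
  have bound: "length Vs \<le> CARD('a set)" if "subgroup_cycle m Vs" for Vs :: "'a set list"
    using that unfolding subgroup_cycle_def
    by (metis card_mono distinct_card finite subset_UNIV)
  obtain Vs :: "'a set list" where Vs: "subgroup_cycle m Vs"
    and max: "\<And>Ws :: 'a set list. subgroup_cycle m Ws \<Longrightarrow> length Ws \<le> length Vs"
    using ex_has_greatest_nat[of "subgroup_cycle m" _ length, OF start] bound
    by (metis le_imp_less_Suc)
  have "T \<in> set Vs" if "card T = m" for T
  proof (rule ccontr)
    assume "T \<notin> set Vs"
    \<comment> \<open>Extending by \<open>T\<close> would double the length of a longest cycle,
      which is not empty.\<close>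
    then have "2 * length Vs \<le> length Vs"
      using max[OF subgroup_cycle_extend[OF Vs that]] by simp
    then show False using Vs unfolding subgroup_cycle_def by simp
  qed
  then have "set Vs = UNIV"
    using Vs assms by (intro sym_diff_closed_eq_UNIV[of _ m]) (auto simp: subgroup_cycle_def)
  with Vs show ?thesis by blast
qed

definition indicator_vec :: "'k set \<Rightarrow> real ^ 'k" where
  "indicator_vec A = (\<chi> i. indicator A i)"

lemma inj_indicator_vec: "inj indicator_vec"
  by (auto simp: inj_on_def indicator_vec_def vec_eq_iff indicator_def split: if_splits)

lemma range_indicator_vec: "range indicator_vec = grid 2"
proof -
  have *: "{0..<2} = {0, 1 :: nat}" by auto
  have "v \<in> range indicator_vec" if "v \<in> grid 2" for v :: "real ^ 'k"
  proof -
    \<comment> \<open>A 0-1 vector is determined by its support.\<close>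
    have "v = indicator_vec {i. v $ i = 1}"
      using that by (auto simp: grid_def * indicator_vec_def vec_eq_iff indicator_def)
    then show ?thesis by blast
  qed
  then show ?thesis
    by (auto simp: grid_def * indicator_vec_def indicator_def)
qed

text \<open>The coordinates of the difference are 1 or -1 on \<open>sym_diff A B\<close> and 0
  elsewhere, so the squared norm counts that set.\<close>

lemma norm_diff_indicator_vec:
  fixes A B :: "'k::finite set"
  shows "norm (indicator_vec A - indicator_vec B) = sqrt (real (card (sym_diff A B)))"
proof -
  have "(\<Sum>i\<in>UNIV. (norm ((indicator_vec A - indicator_vec B) $ i))\<^sup>2)
      = (\<Sum>i\<in>UNIV. if i \<in> sym_diff A B then 1 else 0)"
    by (intro sum.cong) (auto simp: indicator_vec_def indicator_def)
  also have "\<dots> = real (card (sym_diff A B))"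
    by (subst sum.If_cases) (simp_all only: finite Collect_mem_eq Int_UNIV_left real_of_card sum.neutral_const add_0_right)
  finally show ?thesis by (simp add: norm_vec_def L2_set_def)
qed

lemma leaper_jump_indicator_vec:
  "leaper_jump a b (indicator_vec A) (indicator_vec B) \<longleftrightarrow> card (sym_diff A B) = a\<^sup>2 + b\<^sup>2"
proof -
  have "(real a)\<^sup>2 + (real b)\<^sup>2 = real (a\<^sup>2 + b\<^sup>2)" by simp
  then show ?thesis
    unfolding leaper_jump_def norm_diff_indicator_vec by (simp only: real_sqrt_eq_iff of_nat_eq_iff)
qed

text \<open>With an odd number of flipped coordinates, jumps change the parity of the coordinate
  sum; the strict bound rules out that all jumps are antipodal.\<close>

theorem ex_closed_euclidean_tour_cube:
  assumes "odd (a\<^sup>2 + b\<^sup>2)" "a\<^sup>2 + b\<^sup>2 < CARD('k::finite)"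
  shows "\<exists>Vs :: (real ^ 'k) list. closed_euclidean_tour a b 2 Vs"
proof -
  obtain Vs :: "'k set list" where Vs: "subgroup_cycle (a\<^sup>2 + b\<^sup>2) Vs" "set Vs = UNIV"
    using ex_subgroup_cycle_UNIV[OF assms] by blast
  then have "closed_euclidean_tour a b 2 (map indicator_vec Vs)"
    unfolding closed_euclidean_tour_def euclidean_tour_def subgroup_cycle_def
    by (auto simp: distinct_map inj_on_subset[OF inj_indicator_vec] range_indicator_vec
        successively_map last_map hd_map leaper_jump_indicator_vec)
  then show ?thesis by blast
qed

theorem theorem3p3:
  assumes "CARD('k::finite) \<ge> 15"
  shows "\<exists>Vs :: (real ^ 'k) list. closed_euclidean_zebra_tour 2 Vs"
  \<comment> \<open>Here \<open>m\<close> is 4 + 9 = 13, which is odd and below 15.\<close>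
  using assms by (intro ex_closed_euclidean_tour_cube) auto

end
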